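(* Let $T_{a,w}$ be a distributionally chaotic weighted translation operator on $L^p(G)$, $1\le p<\infty$, and let $A,B\subset\mathbb{N}$ with $\overline{\mathrm{dens}}(A)=\overline{\mathrm{dens}}(B)=1$ be such that $DIV_{A,B}=DIV_{A,B}(T_{a,w})$ is nonempty. Define the cone $$\mathcal{C}:=\Big\{\sum_{\text{finite }j}c_j|y_j| : c_j>0,\ y_j\in DIV_{A,B}\Big\}.$$ Then each nonzero vector in $\mathcal{C}$ is a distributionally irregular vector for $T_{a,w}$. Furthermore, if $T_{a,w}$ is invertible, then $\mathcal{C}$ is invariant under the operators $T_a$, $T_{a,w}$, $M_w$, $M_{T_{a^n}w}$ ($n\in\mathbb{Z}$), $M_{\varphi_n}$ ($n\in\mathbb{N}$) and their inverses.
   Context: $G$ is a second countable locally compact Hausdorff group with a right invariant Haar measure $\lambda$; $L^p(G)$ is the complex Lebesgue space with respect to $\lambda$. A weight on $G$ is a bounded continuous function $w:G\to(0,\infty)$. For $a\in G$, $(T_af)(x):=f(xa^{-1})$ and the weighted translation is $T_{a,w}f:=w\,T_af$ for $f\in L^p(G)$; it is invertible when $w^{-1}\in L^\infty(G)$. For a function $u$ on $G$, $(M_uf)(x):=u(x)f(x)$. For $n\in\mathbb{N}=\{1,2,\dots\}$, $\varphi_n:=\prod_{j=1}^nT_{a^{-j}}w$. For $A\subset\mathbb{N}$, $\overline{\mathrm{dens}}(A)=\limsup_{n\to\infty}\frac{\mathrm{card}(A\cap[1,n])}{n}$; $\lim_{n\in A}$ means the limit as $n\to\infty$ with $n\in A$.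 For an operator $T$ on a Banach space $X$ and $A,B\subset\mathbb{N}$ of upper density $1$, $DIV_{A,B}(T)=\{x\in X:\lim_{n\in A}T^nx=0\text{ and }\lim_{n\in B}\|T^nx\|=\infty\}$; $x$ is a distributionally irregular vector for $T$ if $x\in DIV_{A,B}(T)$ for some $A,B$ of upper density $1$. $T$ is distributionally chaotic if there exist an uncountable set $\Gamma\subset X$ and $\varepsilon>0$ such that for every $\tau>0$ and every pair of distinct $x,y\in\Gamma$, $\overline{\mathrm{dens}}\{n\in\mathbb{N}:\|T^nx-T^ny\|\ge\varepsilon\}=1$ and $\overline{\mathrm{dens}}\{n\in\mathbb{N}:\|T^nx-T^ny\|<\tau\}=1$. *)

theory Defs
  imports "HOL-Analysis.Analysis"
begin

text \<open>
  Topological groups are types of class \<open>topological_group_add\<close>. This class does not assume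
  commutativity; only the notation is additive: the product $xy$ is \<open>x + y\<close>, and
  $xa^{-1}$ is \<open>x - a\<close> (which is \<open>x + (- a)\<close>).
\<close>

definition gpow :: "int \<Rightarrow> 'g::group_add \<Rightarrow> 'g" where
  \<comment> \<open>the group power $a^n$, in additive notation\<close>
  "gpow n a = (if 0 \<le> n then (((+) a) ^^ nat n) 0 else - ((((+) a) ^^ nat (- n)) 0))"

definition right_haar_measure :: "'g::topological_group_add measure \<Rightarrow> bool" where
  "right_haar_measure M \<longleftrightarrow>
     sets M = sets borel \<and>
     emeasure M UNIV \<noteq> 0 \<and>
     (\<forall>K. compact K \<longrightarrow> emeasure M K < \<infinity>) \<and>
     (\<forall>E\<in>sets borel. emeasure M E = (INF U\<in>{U. open U \<and> E \<subseteq> U}. emeasure M U)) \<and>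
     (\<forall>U. open U \<longrightarrow>
        emeasure M U = (SUP K\<in>{K. compact K \<and> K \<in> sets borel \<and> K \<subseteq> U}. emeasure M K)) \<and>
     (\<forall>a. \<forall>E\<in>sets borel. emeasure M ((\<lambda>x. x + a) ` E) = emeasure M E)"

definition weight :: "('g::topological_space \<Rightarrow> real) \<Rightarrow> bool" where
  "weight w \<longleftrightarrow> continuous_on UNIV w \<and> bounded (range w) \<and> (\<forall>x. 0 < w x)"


section \<open>The Lebesgue space $L^p$ as a space of equivalence classes\<close>

definition lp_fun :: "'a measure \<Rightarrow> real \<Rightarrow> ('a \<Rightarrow> complex) set" where
  "lp_fun M p = {f \<in> borel_measurable M. integrable M (\<lambda>x. cmod (f x) powr p)}"

definition lp_rel :: "'a measure \<Rightarrow> real \<Rightarrow> (('a \<Rightarrow> complex) \<times> ('a \<Rightarrow> complex)) set" where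
  "lp_rel M p = {(f, g). f \<in> lp_fun M p \<and> g \<in> lp_fun M p \<and> (AE x in M. f x = g x)}"

lemma equiv_lp_rel: "equiv (lp_fun M p) (lp_rel M p)"
proof (rule equivI)
  show "trans (lp_rel M p)"
    by (rule transI) (auto simp: lp_rel_def elim: eventually_elim2)
qed (auto simp: lp_rel_def refl_on_def sym_on_def elim: eventually_mono)

definition Lp :: "'a measure \<Rightarrow> real \<Rightarrow> ('a \<Rightarrow> complex) set set" where
  "Lp M p = lp_fun M p // lp_rel M p"

abbreviation lp_class :: "'a measure \<Rightarrow> real \<Rightarrow> ('a \<Rightarrow> complex) \<Rightarrow> ('a \<Rightarrow> complex) set" where
  "lp_class M p f \<equiv> lp_rel M p `` {f}"

definition Lp_norm :: "'a measure \<Rightarrow> real \<Rightarrow> ('a \<Rightarrow> complex) set \<Rightarrow> real" where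
  "Lp_norm M p u = the_elem ((\<lambda>f. (\<integral>x. cmod (f x) powr p \<partial>M) powr (1 / p)) ` u)"

definition Lp_minus ::
    "'a measure \<Rightarrow> real \<Rightarrow> ('a \<Rightarrow> complex) set \<Rightarrow> ('a \<Rightarrow> complex) set \<Rightarrow> ('a \<Rightarrow> complex) set" where
  "Lp_minus M p u v = (\<Union>f\<in>u. \<Union>g\<in>v. lp_class M p (\<lambda>x. f x - g x))"

text \<open>
  The map on classes induced by a map on functions that preserves \<open>lp_fun M p\<close>
  and almost everywhere equality.
\<close>

definition Lp_lift ::
    "'a measure \<Rightarrow> real \<Rightarrow> (('a \<Rightarrow> complex) \<Rightarrow> ('a \<Rightarrow> complex)) \<Rightarrow>
     ('a \<Rightarrow> complex) set \<Rightarrow> ('a \<Rightarrow> complex) set" where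
  "Lp_lift M p F u = (\<Union>f\<in>u. lp_class M p (F f))"

text \<open>
  Invertibility of a (linear) operator on $L^p$: it is a bijection of $L^p$ and its inverse
  \<open>inv_into (Lp M p) S\<close> (automatically linear) is bounded.
\<close>

definition Lp_invertible ::
    "'a measure \<Rightarrow> real \<Rightarrow> (('a \<Rightarrow> complex) set \<Rightarrow> ('a \<Rightarrow> complex) set) \<Rightarrow> bool" where
  "Lp_invertible M p S \<longleftrightarrow>
     bij_betw S (Lp M p) (Lp M p) \<and>
     (\<exists>K. \<forall>u\<in>Lp M p. Lp_norm M p (inv_into (Lp M p) S u) \<le> K * Lp_norm M p u)"


section \<open>Weighted translations\<close>

definition translate :: "'g::group_add \<Rightarrow> ('g \<Rightarrow> 'b) \<Rightarrow> 'g \<Rightarrow> 'b" where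
  "translate a f = (\<lambda>x. f (x - a))"

definition multiply :: "('a \<Rightarrow> real) \<Rightarrow> ('a \<Rightarrow> complex) \<Rightarrow> 'a \<Rightarrow> complex" where
  "multiply u f = (\<lambda>x. complex_of_real (u x) * f x)"

definition transl_op ::
    "'g::group_add measure \<Rightarrow> real \<Rightarrow> 'g \<Rightarrow> ('g \<Rightarrow> complex) set \<Rightarrow> ('g \<Rightarrow> complex) set" where
  "transl_op M p a = Lp_lift M p (translate a)"

definition mult_op ::
    "'a measure \<Rightarrow> real \<Rightarrow> ('a \<Rightarrow> real) \<Rightarrow> ('a \<Rightarrow> complex) set \<Rightarrow> ('a \<Rightarrow> complex) set" where
  "mult_op M p u = Lp_lift M p (multiply u)"

definition weighted_transl_op ::
    "'g::group_add measure \<Rightarrow> real \<Rightarrow> 'g \<Rightarrow> ('g \<Rightarrow> real) \<Rightarrow>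
     ('g \<Rightarrow> complex) set \<Rightarrow> ('g \<Rightarrow> complex) set" where
  "weighted_transl_op M p a w = Lp_lift M p (\<lambda>f. multiply w (translate a f))"

definition weight_prod :: "'g::group_add \<Rightarrow> ('g \<Rightarrow> real) \<Rightarrow> nat \<Rightarrow> 'g \<Rightarrow> real" where
  \<comment> \<open>$\varphi_n = \prod_{j=1}^n T_{a^{-j}} w$\<close>
  "weight_prod a w n = (\<lambda>x. \<Prod>j=1..n. translate (gpow (- int j) a) w x)"


section \<open>Distributional chaos\<close>

text \<open>
  The positive integers are \<open>{1..} :: nat set\<close>. The general notions are stated for a map
  \<open>T\<close> on a normed space with underlying set \<open>X\<close>, norm \<open>nrm\<close> and
  subtraction \<open>sub\<close>.
\<close>

definition upper_dens :: "nat set \<Rightarrow> ereal" where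
  "upper_dens A = limsup (\<lambda>n. ereal (real (card (A \<inter> {1..n})) / real n))"

definition along :: "nat set \<Rightarrow> nat filter" where
  "along A = inf sequentially (principal A)"

definition DIV ::
    "'v set \<Rightarrow> ('v \<Rightarrow> real) \<Rightarrow> ('v \<Rightarrow> 'v) \<Rightarrow> nat set \<Rightarrow> nat set \<Rightarrow> 'v set" where
  "DIV X nrm T A B =
     {x \<in> X. ((\<lambda>n. nrm ((T ^^ n) x)) \<longlongrightarrow> 0) (along A) \<and>
             filterlim (\<lambda>n. nrm ((T ^^ n) x)) at_top (along B)}"

definition dist_irregular :: "'v set \<Rightarrow> ('v \<Rightarrow> real) \<Rightarrow> ('v \<Rightarrow> 'v) \<Rightarrow> 'v \<Rightarrow> bool" where
  "dist_irregular X nrm T x \<longleftrightarrow>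
     (\<exists>A B. A \<subseteq> {1..} \<and> B \<subseteq> {1..} \<and> upper_dens A = 1 \<and> upper_dens B = 1 \<and> x \<in> DIV X nrm T A B)"

definition dist_chaotic ::
    "'v set \<Rightarrow> ('v \<Rightarrow> real) \<Rightarrow> ('v \<Rightarrow> 'v \<Rightarrow> 'v) \<Rightarrow> ('v \<Rightarrow> 'v) \<Rightarrow> bool" where
  "dist_chaotic X nrm sub T \<longleftrightarrow>
     (\<exists>\<Gamma> \<epsilon>. \<Gamma> \<subseteq> X \<and> uncountable \<Gamma> \<and> 0 < \<epsilon> \<and>
        (\<forall>\<tau>>0. \<forall>x\<in>\<Gamma>. \<forall>y\<in>\<Gamma>. x \<noteq> y \<longrightarrow>
           upper_dens {n\<in>{1..}. \<epsilon> \<le> nrm (sub ((T ^^ n) x) ((T ^^ n) y))} = 1 \<and>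
           upper_dens {n\<in>{1..}. nrm (sub ((T ^^ n) x) ((T ^^ n) y)) < \<tau>} = 1))"

text \<open>
  The cone of finite combinations $\sum_j c_j |y_j|$ with $c_j > 0$ and \<open>y j \<in> D\<close>, computed on
  representatives \<open>f j \<in> y j\<close>. The empty combination is allowed and contributes the zero vector.
\<close>

definition Lp_cone ::
    "'a measure \<Rightarrow> real \<Rightarrow> ('a \<Rightarrow> complex) set set \<Rightarrow> ('a \<Rightarrow> complex) set set" where
  "Lp_cone M p D =
     {lp_class M p (\<lambda>x. \<Sum>j<m. complex_of_real (c j) * complex_of_real (cmod (f j x))) | m c y f.
        \<forall>j<m::nat. 0 < c j \<and> y j \<in> D \<and> f j \<in> y j}"

end

theory Submission
  imports Defs
begin

text \<open>
  Everything is computed on representatives. Since \<open>w\<close> is positive, the linear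
  operator $T = T_{a,w}$ commutes with $f \mapsto |f|$, so
  $T^n \sum_j c_j |f_j| = \sum_j c_j |T^n f_j|$ pointwise. The norm of the right-hand side tends to $0$
  whenever all the norms $\|T^n f_j\|$ do (\<open>cone_fun_lp\<close>), and it is at least
  $c_0 \|T^n f_0\|$. A nonzero element of the cone involves at least one term and so lies in
  $DIV_{A,B}$ itself (\<open>cone_nonzero_irregular\<close>), with the same sets $A$ and $B$.

  If $T$ is invertible, then $\|f\| \le L \|Tf\|$ for some $L$. Testing this on the indicator of a
  compact set of positive measure on which \<open>w\<close> is small shows that \<open>w\<close> is bounded
  below by a positive constant (\<open>invertible_imp_tame\<close>). Consequently each of the listed operators
  has the form $S f = u\, T_b f$, where $b$ is $a$ or the identity and $u$ is bounded above and bounded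
  away from $0$. Such an $S$ is invertible and $S^{-1}$ has the same form with $-b$ for $b$. Up to a
  factor bounded above and below, $S$ commutes with all powers of $T$: on the one hand
  $T^n M_u = M_{u'} T^n$, where $u'$ is a translate of $u$ and hence obeys the same bounds; on
  the other hand $u\, T_a f = (u/w)\, T f$, and $T$ commutes with its own powers. Therefore
  $\|T^n S y\|$ and $\|T^n y\|$ are comparable uniformly in $n$, and
  $S y \in DIV_{A,B}$ if and only if $y \in DIV_{A,B}$ (\<open>tame_op_DIV_iff\<close>). As $S$ also commutes
  with the formation of cone combinations, this equivalence passes to the cone in both
  directions (\<open>tame_op_cone\<close>).
\<close>

section \<open>Functions with integrable $p$-th power\<close>

definition lp_fnorm :: "'a measure \<Rightarrow> real \<Rightarrow> ('a \<Rightarrow> complex) \<Rightarrow> real" where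
  "lp_fnorm M p f = (\<integral>x. cmod (f x) powr p \<partial>M) powr (1 / p)"

lemma lp_fnorm_nonneg: "0 \<le> lp_fnorm M p f"
  by (simp add: lp_fnorm_def)

lemma lp_fnorm_powr: "0 < p \<Longrightarrow> lp_fnorm M p f powr p = (\<integral>x. cmod (f x) powr p \<partial>M)"
  by (simp add: lp_fnorm_def powr_powr)

lemma lp_fun_dominated:
  assumes p: "0 < p" and f: "f \<in> borel_measurable M" and g: "g \<in> lp_fun M p" and c: "0 \<le> c"
    and le: "\<And>x. cmod (f x) \<le> c * cmod (g x)"
  shows "f \<in> lp_fun M p" and "lp_fnorm M p f \<le> c * lp_fnorm M p g"
proof -
  have le': "cmod (f x) powr p \<le> c powr p * (cmod (g x) powr p)" for x
    using powr_mono2[OF _ _ le, of p x] p c by (simp add: powr_mult)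
  have int: "integrable M (\<lambda>x. c powr p * (cmod (g x) powr p))"
    using g by (simp add: lp_fun_def)
  show "f \<in> lp_fun M p"
    unfolding lp_fun_def using f le'
    by (auto intro!: Bochner_Integration.integrable_bound[OF int])
  have "(\<integral>x. cmod (f x) powr p \<partial>M) \<le> c powr p * (\<integral>x. cmod (g x) powr p \<partial>M)"
    using integral_mono'[OF int le'] by simp
  hence "lp_fnorm M p f \<le> (c powr p * (\<integral>x. cmod (g x) powr p \<partial>M)) powr (1 / p)"
    unfolding lp_fnorm_def using p by (intro powr_mono2) auto
  also have "\<dots> = c * lp_fnorm M p g"
    using p c by (simp add: lp_fnorm_def powr_mult powr_powr)
  finally show "lp_fnorm M p f \<le> c * lp_fnorm M p g" .
qed

definition cone_fun :: "nat \<Rightarrow> (nat \<Rightarrow> real) \<Rightarrow> (nat \<Rightarrow> 'a \<Rightarrow> complex) \<Rightarrow> 'a \<Rightarrow> complex" where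
  "cone_fun m c f = (\<lambda>x. \<Sum>j<m. complex_of_real (c j) * complex_of_real (cmod (f j x)))"

lemma cmod_cone_fun:
  assumes "\<And>j. j < m \<Longrightarrow> 0 < c j"
  shows "cmod (cone_fun m c f x) = (\<Sum>j<m. c j * cmod (f j x))"
proof -
  have "cone_fun m c f x = complex_of_real (\<Sum>j<m. c j * cmod (f j x))"
    by (simp add: cone_fun_def)
  moreover have "0 \<le> (\<Sum>j<m. c j * cmod (f j x))"
    using assms by (intro sum_nonneg) (simp add: less_imp_le)
  ultimately show ?thesis by (simp only: norm_of_real abs_of_nonneg)
qed

text \<open>
  A sum of $m$ nonnegative numbers is at most $m$ times the largest of them; this crude
  substitute for Minkowski's inequality is enough for qualitative statements.
\<close>

lemma powr_sum_le:
  fixes t :: "nat \<Rightarrow> real"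
  assumes p: "0 < p" and t: "\<And>j. j < m \<Longrightarrow> 0 \<le> t j"
  shows "(\<Sum>j<m. t j) powr p \<le> real m powr p * (\<Sum>j<m. t j powr p)"
proof (cases "m = 0")
  case False
  define s where "s = Max (t ` {..<m})"
  have "s \<in> t ` {..<m}"
    unfolding s_def using False by (intro Max_in) auto
  then obtain i where i: "i < m" "s = t i" by auto
  have "t j \<le> s" if "j < m" for j
    unfolding s_def using that by (intro Max_ge) auto
  hence "(\<Sum>j<m. t j) \<le> real m * s"
    using sum_bounded_above[of "{..<m}" t s] by simp
  hence "(\<Sum>j<m. t j) powr p \<le> (real m * s) powr p"
    using p t by (intro powr_mono2 sum_nonneg) auto
  also have "\<dots> = real m powr p * (t i powr p)"
    using t i by (simp add: powr_mult)
  also have "\<dots> \<le> real m powr p * (\<Sum>j<m. t j powr p)"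
    using i by (intro mult_left_mono member_le_sum) auto
  finally show ?thesis .
qed simp

text \<open>
  The bound on the norm is weaker than the triangle inequality, but it tends to $0$ as soon as the
  norms of all the \<open>f j\<close> do, and that is its only purpose.
\<close>

lemma cone_fun_lp:
  assumes p: "0 < p" and c: "\<And>j. j < m \<Longrightarrow> 0 < c j" and f: "\<And>j. j < m \<Longrightarrow> f j \<in> lp_fun M p"
  shows "cone_fun m c f \<in> lp_fun M p"
    and "lp_fnorm M p (cone_fun m c f)
           \<le> (real m powr p * (\<Sum>j<m. c j powr p * lp_fnorm M p (f j) powr p)) powr (1 / p)"
proof -
  have le: "cmod (cone_fun m c f x) powr p
      \<le> real m powr p * (\<Sum>j<m. c j powr p * cmod (f j x) powr p)" for x
  proof -
    have "cmod (cone_fun m c f x) powr p \<le> real m powr p * (\<Sum>j<m. (c j * cmod (f j x)) powr p)"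
      by (subst cmod_cone_fun, erule c, rule powr_sum_le[OF p]) (use c in \<open>simp add: less_imp_le\<close>)
    also have "(\<Sum>j<m. (c j * cmod (f j x)) powr p) = (\<Sum>j<m. c j powr p * cmod (f j x) powr p)"
      using c by (intro sum.cong) (auto simp: powr_mult less_imp_le)
    finally show ?thesis .
  qed
  have int: "integrable M (\<lambda>x. real m powr p * (\<Sum>j<m. c j powr p * cmod (f j x) powr p))"
    using f by (intro integrable_mult_right integrable_sum) (auto simp: lp_fun_def)
  have meas: "cone_fun m c f \<in> borel_measurable M"
    unfolding cone_fun_def using f
    by (intro borel_measurable_sum borel_measurable_times borel_measurable_const
          measurable_compose[OF _ borel_measurable_of_real]
          measurable_compose[OF _ borel_measurable_norm])
      (auto simp: lp_fun_def)
  show "cone_fun m c f \<in> lp_fun M p"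
    unfolding lp_fun_def using meas order.trans[OF le abs_ge_self]
    by (auto intro!: Bochner_Integration.integrable_bound[OF int])
  have "(\<integral>x. cmod (cone_fun m c f x) powr p \<partial>M)
      \<le> (\<integral>x. real m powr p * (\<Sum>j<m. c j powr p * cmod (f j x) powr p) \<partial>M)"
    by (rule integral_mono'[OF int le]) (auto intro!: mult_nonneg_nonneg sum_nonneg)
  also have "\<dots> = real m powr p * (\<Sum>j<m. c j powr p * (\<integral>x. cmod (f j x) powr p \<partial>M))"
    using f by (subst integral_mult_right_zero, subst Bochner_Integration.integral_sum)
      (auto simp: lp_fun_def)
  also have "\<dots> = real m powr p * (\<Sum>j<m. c j powr p * lp_fnorm M p (f j) powr p)"
    using p by (simp add: lp_fnorm_powr)
  finally show "lp_fnorm M p (cone_fun m c f)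
      \<le> (real m powr p * (\<Sum>j<m. c j powr p * lp_fnorm M p (f j) powr p)) powr (1 / p)"
    unfolding lp_fnorm_def[of M p "cone_fun m c f"] using p by (intro powr_mono2) auto
qed

section \<open>Classes and induced maps\<close>

lemma LpE:
  assumes "u \<in> Lp M p"
  obtains f where "f \<in> lp_fun M p" "u = lp_class M p f"
  using assms by (auto simp: Lp_def elim: quotientE)

lemma lp_class_in_Lp: "f \<in> lp_fun M p \<Longrightarrow> lp_class M p f \<in> Lp M p"
  by (simp add: Lp_def quotientI)

lemma lp_class_self: "f \<in> lp_fun M p \<Longrightarrow> f \<in> lp_class M p f"
  by (simp add: lp_rel_def)

lemma lp_class_eq_iff:
  "f \<in> lp_fun M p \<Longrightarrow> g \<in> lp_fun M p \<Longrightarrow>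
    lp_class M p f = lp_class M p g \<longleftrightarrow> (AE x in M. f x = g x)"
  by (subst eq_equiv_class_iff[OF equiv_lp_rel]) (auto simp: lp_rel_def)

lemma Lp_member:
  assumes "u \<in> Lp M p" "f \<in> u"
  shows "f \<in> lp_fun M p" "u = lp_class M p f"
proof -
  obtain g where g: "g \<in> lp_fun M p" "u = lp_class M p g" using assms(1) by (rule LpE)
  with assms(2) have fg: "(g, f) \<in> lp_rel M p" by auto
  thus "f \<in> lp_fun M p" by (simp add: lp_rel_def)
  show "u = lp_class M p f" using equiv_class_eq[OF equiv_lp_rel fg] g by simp
qed

lemma Lp_norm_class:
  assumes f: "f \<in> lp_fun M p"
  shows "Lp_norm M p (lp_class M p f) = lp_fnorm M p f"
proof -
  have "lp_fnorm M p g = lp_fnorm M p f" if "g \<in> lp_class M p f" for g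
  proof -
    have g: "g \<in> lp_fun M p" and ae: "AE x in M. f x = g x" using that by (auto simp: lp_rel_def)
    have "(\<integral>x. cmod (g x) powr p \<partial>M) = (\<integral>x. cmod (f x) powr p \<partial>M)"
      using f g ae by (intro integral_cong_AE) (auto simp: lp_fun_def elim: eventually_mono)
    thus ?thesis by (simp add: lp_fnorm_def)
  qed
  moreover have "lp_class M p f \<noteq> {}" using lp_class_self[OF f] by blast
  ultimately have "the_elem (lp_fnorm M p ` lp_class M p f) = lp_fnorm M p f"
    by (intro the_elem_image_unique)
  thus ?thesis unfolding Lp_norm_def lp_fnorm_def[abs_def] .
qed

lemma Lp_lift_class:
  assumes lp: "\<And>f. f \<in> lp_fun M p \<Longrightarrow> F f \<in> lp_fun M p"
    and ae: "\<And>f g. AE x in M. f x = g x \<Longrightarrow> AE x in M. F f x = F g x"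
    and f: "f \<in> lp_fun M p"
  shows "Lp_lift M p F (lp_class M p f) = lp_class M p (F f)"
proof -
  have "lp_class M p (F g) = lp_class M p (F f)" if "g \<in> lp_class M p f" for g
  proof -
    have "g \<in> lp_fun M p" "AE x in M. g x = f x"
      using that by (auto simp: lp_rel_def elim: eventually_mono)
    thus ?thesis using f by (simp add: lp_class_eq_iff lp ae)
  qed
  thus ?thesis unfolding Lp_lift_def using lp_class_self[OF f] by blast
qed

lemma Lp_coneI:
  "(\<And>j. j < m \<Longrightarrow> 0 < c j \<and> y j \<in> D \<and> f j \<in> y j) \<Longrightarrow>
    lp_class M p (cone_fun m c f) \<in> Lp_cone M p D"
  unfolding Lp_cone_def cone_fun_def by blast

lemma Lp_coneE:
  assumes "u \<in> Lp_cone M p D"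
  obtains m c y f where "\<And>j. j < m \<Longrightarrow> 0 < c j \<and> y j \<in> D \<and> f j \<in> y j"
    "u = lp_class M p (cone_fun m c f)"
  using assms unfolding Lp_cone_def cone_fun_def by blast

section \<open>Weighted translations on functions\<close>

text \<open>
  Translations and multiplications are both weighted translations, by the weight $1$ and by the neutral
  element respectively; this lets one argument serve all the operators of the theorem.
\<close>

abbreviation wshift :: "'g::group_add \<Rightarrow> ('g \<Rightarrow> real) \<Rightarrow> ('g \<Rightarrow> complex) \<Rightarrow> 'g \<Rightarrow> complex" where
  "wshift b u f \<equiv> multiply u (translate b f)"

lemma mult_op_eq: "mult_op M p u = weighted_transl_op M p 0 u"
  by (simp add: mult_op_def weighted_transl_op_def translate_def)

lemma transl_op_eq: "transl_op M p b = weighted_transl_op M p b (\<lambda>_. 1)"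
  by (simp add: transl_op_def weighted_transl_op_def multiply_def)

lemma wshift_cone_fun:
  assumes "\<And>x. 0 \<le> u x"
  shows "wshift b u (cone_fun m c f) = cone_fun m c (\<lambda>j. wshift b u (f j))"
  using assms
  by (intro ext) (simp add: cone_fun_def multiply_def translate_def norm_mult sum_distrib_left mult_ac)

lemma wshift_funpow_cone_fun:
  assumes "\<And>x. 0 \<le> u x"
  shows "(wshift b u ^^ n) (cone_fun m c f) = cone_fun m c (\<lambda>j. (wshift b u ^^ n) (f j))"
  by (induction n) (simp_all add: wshift_cone_fun[OF assms])

text \<open>
  Each application of $T_{a,w}$ moves the multiplier \<open>u\<close> one translation further, which
  does not change its range. So multiplication by a \<open>u\<close> that is bounded above and away from $0$
  commutes with all powers of
  $T_{a,w}$ up to a factor whose bounds do not depend on \<open>n\<close>.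
\<close>

lemma wshift_funpow_multiply:
  "(wshift a w ^^ n) (multiply u f) = multiply ((translate a ^^ n) u) ((wshift a w ^^ n) f)"
  by (induction n) (simp_all add: multiply_def translate_def fun_eq_iff)

lemma wshift_inverse:
  assumes "\<And>x. u x \<noteq> 0"
  shows "wshift b u (wshift (- b) (\<lambda>x. 1 / u (x + b)) f) = f"
    and "wshift (- b) (\<lambda>x. 1 / u (x + b)) (wshift b u f) = f"
  using assms by (simp_all add: multiply_def translate_def fun_eq_iff)

text \<open>
  Tame weights give weighted translations that are bounded and have a bounded inverse. The bounds are explicit
  parameters because uniformity over all translates of a weight is needed.
\<close>

definition tame :: "real \<Rightarrow> real \<Rightarrow> ('g::topological_space \<Rightarrow> real) \<Rightarrow> bool" where
  "tame d K u \<longleftrightarrow> 0 < d \<and> u \<in> borel_measurable borel \<and> (\<forall>x. d \<le> u x \<and> u x \<le> K)"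

lemma tame_pos: "tame d K u \<Longrightarrow> 0 < u x"
  unfolding tame_def by (meson less_le_trans)

lemma continuous_shift:
  fixes b :: "'g::topological_group_add"
  shows "continuous_on UNIV (\<lambda>x. x + b)"
  by (intro continuous_on_add continuous_on_id continuous_on_const)

lemma shift_measurable:
  fixes b :: "'g::topological_group_add"
  shows "(\<lambda>x. x - b) \<in> borel_measurable borel"
  using borel_measurable_continuous_onI[OF continuous_shift[of "- b"]] by simp

lemma tame_translate:
  fixes b :: "'g::topological_group_add"
  assumes "tame d K u"
  shows "tame d K (translate b u)"
  using assms measurable_compose[OF shift_measurable[of b], of u]
  by (auto simp: tame_def translate_def)

lemma tame_translate_funpow:
  fixes a :: "'g::topological_group_add"
  assumes "tame d K u"
  shows "tame d K ((translate a ^^ n) u)"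
  by (induction n) (simp_all add: assms tame_translate)

lemma tame_bounds_le: "tame d K u \<Longrightarrow> d \<le> K"
  unfolding tame_def by (meson order.trans)

lemma tame_inverse:
  assumes "tame d K u"
  shows "tame (1 / K) (1 / d) (\<lambda>x. 1 / u x)"
proof -
  have "0 < K" using assms tame_bounds_le[OF assms] by (simp add: tame_def)
  thus ?thesis using assms tame_pos[OF assms] unfolding tame_def
    by (auto intro!: divide_left_mono mult_pos_pos)
qed

lemma tame_mult:
  assumes "tame d K u" "tame d' K' v"
  shows "tame (d * d') (K * K') (\<lambda>x. u x * v x)"
  using assms tame_pos[OF assms(1)] tame_pos[OF assms(2)] tame_bounds_le[OF assms(1)]
  unfolding tame_def by (auto intro!: mult_mono simp: less_imp_le)

lemma tame_prod:
  assumes "\<And>j. j \<in> J \<Longrightarrow> tame d K (u j)" and "finite J"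
  shows "tame (d ^ card J) (K ^ card J) (\<lambda>x. \<Prod>j\<in>J. u j x)"
  using assms(2,1)
proof (induction J)
  case empty
  show ?case by (simp add: tame_def)
next
  case (insert i J)
  hence "tame (d * d ^ card J) (K * K ^ card J) (\<lambda>x. u i x * (\<Prod>j\<in>J. u j x))"
    by (intro tame_mult) simp_all
  thus ?case using insert.hyps by simp
qed

section \<open>Weighted translations on $L^p$ of a right Haar measure\<close>

locale haar_Lp =
  fixes M :: "'g::{topological_group_add, second_countable_topology} measure" and p :: real
  assumes haar: "right_haar_measure M" and p: "1 \<le> p"
begin

lemma sets_M [measurable_cong]: "sets M = sets borel"
  and emeasure_UNIV: "emeasure M UNIV \<noteq> 0"
  and compact_finite: "compact E \<Longrightarrow> emeasure M E < \<infinity>"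
  and inner_regular: "open U \<Longrightarrow>
    emeasure M U = (SUP E\<in>{E. compact E \<and> E \<in> sets borel \<and> E \<subseteq> U}. emeasure M E)"
  and right_invariant: "E \<in> sets borel \<Longrightarrow> emeasure M ((\<lambda>x. x + b) ` E) = emeasure M E"
proof -
  note H = haar[unfolded right_haar_measure_def]
  show "sets M = sets borel" using H by (rule conjunct1)
  note H = H[THEN conjunct2]
  show "emeasure M UNIV \<noteq> 0" using H by (rule conjunct1)
  note H = H[THEN conjunct2]
  show "compact E \<Longrightarrow> emeasure M E < \<infinity>" by (rule H[THEN conjunct1, rule_format])
  note H = H[THEN conjunct2, THEN conjunct2]
  show "open U \<Longrightarrow>
    emeasure M U = (SUP E\<in>{E. compact E \<and> E \<in> sets borel \<and> E \<subseteq> U}. emeasure M E)"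
    by (rule H[THEN conjunct1, rule_format])
  show "E \<in> sets borel \<Longrightarrow> emeasure M ((\<lambda>x. x + b) ` E) = emeasure M E"
    by (rule H[THEN conjunct2, rule_format])
qed

lemma space_M: "space M = UNIV"
  using sets_eq_imp_space_eq[OF sets_M] by simp

lemma borel_measurable_M: "borel_measurable M = (borel_measurable borel :: ('g \<Rightarrow> 'b::topological_space) set)"
  by (rule measurable_cong_sets[OF sets_M refl])

lemma shift_measurable_M: "(\<lambda>x. x - b) \<in> measurable M M"
  using shift_measurable[of b] measurable_cong_sets[OF sets_M sets_M] by simp

lemma distr_shift: "distr M M (\<lambda>x. x - b) = M"
proof (rule measure_eqI)
  fix E assume "E \<in> sets (distr M M (\<lambda>x. x - b))"
  hence E: "E \<in> sets M" by simp
  have "(\<lambda>x. x - b) -` E \<inter> space M = (\<lambda>x. x + b) ` E"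
    by (auto simp: space_M image_iff) (metis diff_add_cancel)
  thus "emeasure (distr M M (\<lambda>x. x - b)) E = emeasure M E"
    using E sets_M by (simp add: emeasure_distr[OF shift_measurable_M] right_invariant)
qed simp

lemma AE_translate:
  assumes "AE x in M. f x = g x"
  shows "AE x in M. translate b f x = translate b g x"
proof -
  have "AE x in distr M M (\<lambda>x. x - b). f x = g x"
    using assms by (simp only: distr_shift)
  thus ?thesis
    unfolding translate_def by (rule AE_distrD[OF shift_measurable_M])
qed

lemma translate_lp:
  assumes "f \<in> lp_fun M p"
  shows "translate b f \<in> lp_fun M p" and "lp_fnorm M p (translate b f) = lp_fnorm M p f"
proof -
  have f: "f \<in> borel_measurable M" "integrable M (\<lambda>x. cmod (f x) powr p)"
    using assms by (auto simp: lp_fun_def)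
  show "translate b f \<in> lp_fun M p"
    unfolding lp_fun_def translate_def
    using f measurable_compose[OF shift_measurable_M[of b] f(1)]
      integrable_distr[OF shift_measurable_M[of b], of "\<lambda>x. cmod (f x) powr p"]
    by (simp add: distr_shift)
  have "(\<lambda>x. cmod (f x) powr p) \<in> borel_measurable M" using f by simp
  from integral_distr[OF shift_measurable_M[of b] this]
  show "lp_fnorm M p (translate b f) = lp_fnorm M p f"
    by (simp add: lp_fnorm_def translate_def distr_shift)
qed

lemma wshift_lp:
  assumes u: "u \<in> borel_measurable borel" "\<And>x. 0 \<le> u x \<and> u x \<le> K" and f: "f \<in> lp_fun M p"
  shows "wshift b u f \<in> lp_fun M p" and "lp_fnorm M p (wshift b u f) \<le> K * lp_fnorm M p f"
proof -
  note f' = translate_lp[OF f, of b]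
  have K: "0 \<le> K" using u(2)[of undefined] by linarith
  have [measurable]: "u \<in> borel_measurable M" "translate b f \<in> borel_measurable M"
    using f'(1) u(1) by (simp_all only: borel_measurable_M lp_fun_def mem_Collect_eq)
  have meas: "wshift b u f \<in> borel_measurable M"
    unfolding multiply_def by measurable
  have le: "cmod (wshift b u f x) \<le> K * cmod (translate b f x)" for x
    using u(2)[of x] by (simp add: multiply_def norm_mult mult_right_mono)
  show "wshift b u f \<in> lp_fun M p" and "lp_fnorm M p (wshift b u f) \<le> K * lp_fnorm M p f"
    using lp_fun_dominated[OF _ meas f'(1) K le] p f'(2) by simp_all
qed

lemma AE_wshift: "AE x in M. f x = g x \<Longrightarrow> AE x in M. wshift b u f x = wshift b u g x"
  by (drule AE_translate[of f g b]) (auto simp: multiply_def)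

lemma weighted_transl_op_class:
  assumes u: "u \<in> borel_measurable borel" "\<And>x. 0 \<le> u x \<and> u x \<le> K" and f: "f \<in> lp_fun M p"
  shows "weighted_transl_op M p b u (lp_class M p f) = lp_class M p (wshift b u f)"
  unfolding weighted_transl_op_def
  by (rule Lp_lift_class) (use wshift_lp(1)[OF u] AE_wshift f in auto)

lemma weighted_transl_op_funpow:
  assumes u: "u \<in> borel_measurable borel" "\<And>x. 0 \<le> u x \<and> u x \<le> K" and f: "f \<in> lp_fun M p"
  shows "(wshift b u ^^ n) f \<in> lp_fun M p"
    and "(weighted_transl_op M p b u ^^ n) (lp_class M p f) = lp_class M p ((wshift b u ^^ n) f)"
    and "Lp_norm M p ((weighted_transl_op M p b u ^^ n) (lp_class M p f))
           = lp_fnorm M p ((wshift b u ^^ n) f)"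
proof -
  have "(wshift b u ^^ n) f \<in> lp_fun M p \<and>
    (weighted_transl_op M p b u ^^ n) (lp_class M p f) = lp_class M p ((wshift b u ^^ n) f)"
    by (induction n) (use f wshift_lp(1)[OF u] weighted_transl_op_class[OF u] in auto)
  thus "(wshift b u ^^ n) f \<in> lp_fun M p"
    and "(weighted_transl_op M p b u ^^ n) (lp_class M p f) = lp_class M p ((wshift b u ^^ n) f)"
    and "Lp_norm M p ((weighted_transl_op M p b u ^^ n) (lp_class M p f))
           = lp_fnorm M p ((wshift b u ^^ n) f)"
    by (auto simp: Lp_norm_class)
qed

text \<open>
  The two-sided norm estimate, with constants that depend only on the bounds of the weight: the upper
  one is domination of \<open>wshift b u f\<close> by the translate of \<open>f\<close>, the lower one
  is domination in the opposite direction, and the translate has the norm of \<open>f\<close> by right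
  invariance.
\<close>

lemma tame_wshift:
  assumes u: "tame d K u" and f: "f \<in> lp_fun M p"
  shows "wshift b u f \<in> lp_fun M p"
    and "d * lp_fnorm M p f \<le> lp_fnorm M p (wshift b u f)"
    and "lp_fnorm M p (wshift b u f) \<le> K * lp_fnorm M p f"
    and "weighted_transl_op M p b u (lp_class M p f) = lp_class M p (wshift b u f)"
proof -
  have u': "u \<in> borel_measurable borel" "\<And>x. 0 \<le> u x \<and> u x \<le> K" and d: "0 < d"
    using u tame_pos[OF u] by (auto simp: tame_def less_imp_le)
  note W = wshift_lp[OF u' f]
  show "wshift b u f \<in> lp_fun M p" "lp_fnorm M p (wshift b u f) \<le> K * lp_fnorm M p f"
    by (rule W)+
  show "weighted_transl_op M p b u (lp_class M p f) = lp_class M p (wshift b u f)"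
    by (rule weighted_transl_op_class[OF u' f])
  have "cmod (translate b f x) \<le> (1 / d) * cmod (wshift b u f x)" for x
  proof -
    have "d * cmod (translate b f x) \<le> cmod (wshift b u f x)"
      using u tame_pos[OF u, of x]
      by (auto simp: multiply_def norm_mult tame_def intro!: mult_right_mono)
    thus ?thesis using d by (simp add: field_simps)
  qed
  from lp_fun_dominated(2)[OF _ _ W(1) _ this] translate_lp[OF f, of b] p d
  show "d * lp_fnorm M p f \<le> lp_fnorm M p (wshift b u f)"
    by (simp add: lp_fun_def field_simps)
qed

lemma tame_wshift_inverse_tame:
  fixes u :: "'g \<Rightarrow> real"
  shows "tame d K u \<Longrightarrow> tame (1 / K) (1 / d) (\<lambda>x. 1 / u (x + b))"
  using tame_translate[OF tame_inverse, of d K u "- b"] by (simp add: translate_def)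

lemma tame_op_bij:
  assumes u: "tame d K u"
  shows "bij_betw (weighted_transl_op M p b u) (Lp M p) (Lp M p)"
proof -
  let ?u' = "\<lambda>x. 1 / u (x + b)"
  note u' = tame_wshift_inverse_tame[OF u, of b]
  have nz: "u x \<noteq> 0" for x using tame_pos[OF u, of x] by simp
  show ?thesis
    by (rule bij_betw_byWitness[where f' = "weighted_transl_op M p (- b) ?u'"])
       (auto elim!: LpE simp: tame_wshift[OF u] tame_wshift[OF u'] wshift_inverse[where u = u, OF nz]
          intro!: lp_class_in_Lp)
qed

lemma tame_op_invertible:
  assumes u: "tame d K u"
  shows "Lp_invertible M p (weighted_transl_op M p b u)"
  unfolding Lp_invertible_def
proof (intro conjI exI ballI)
  let ?S = "weighted_transl_op M p b u"
  show bij: "bij_betw ?S (Lp M p) (Lp M p)" by (rule tame_op_bij[OF u])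
  fix v assume v: "v \<in> Lp M p"
  have "inv_into (Lp M p) ?S v \<in> Lp M p"
    using v bij by (metis bij_betw_def inv_into_into)
  then obtain f where f: "f \<in> lp_fun M p" "inv_into (Lp M p) ?S v = lp_class M p f" by (rule LpE)
  have "v = ?S (inv_into (Lp M p) ?S v)"
    using v bij by (simp add: bij_betw_inv_into_right)
  hence "v = lp_class M p (wshift b u f)" using f tame_wshift(4)[OF u f(1)] by simp
  moreover have "0 < d" using u by (simp add: tame_def)
  ultimately show "Lp_norm M p (inv_into (Lp M p) ?S v) \<le> (1 / d) * Lp_norm M p v"
    using f tame_wshift[OF u f(1), of b] by (simp add: Lp_norm_class field_simps)
qed

section \<open>Invertibility bounds the weight away from zero\<close>

text \<open>
  By second countability, countably many right translates of a nonempty open set cover the group. If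
  the set were null, all of them would be null by invariance, and so would be the group.
\<close>

lemma open_emeasure_pos:
  fixes U :: "'g set"
  assumes U: "open U" "U \<noteq> {}"
  shows "emeasure M U \<noteq> 0"
proof
  assume 0: "emeasure M U = 0"
  define V where "V b = (\<lambda>x. x + b) ` U" for b
  have V: "V b = (\<lambda>x. x + - b) -` U" for b
    by (auto simp: V_def image_iff) (metis diff_add_cancel)
  have op: "open (V b)" for b
    unfolding V by (intro open_vimage U continuous_shift)
  have "V b \<in> null_sets M" for b
    using right_invariant[of U b] 0 U op[of b] sets_M by (simp add: null_sets_def V_def)
  moreover obtain \<F> where \<F>: "\<F> \<subseteq> range V" "countable \<F>" "\<Union>\<F> = \<Union>(range V)"
    using Lindelof[of "range V"] op by auto
  ultimately have "(\<Union>W\<in>\<F>. W) \<in> null_sets M"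
    by (intro null_sets_UN') auto
  moreover have "(\<Union>W\<in>\<F>. W) = UNIV"
  proof -
    obtain x where x: "x \<in> U" using U by auto
    have "y \<in> V (- x + y)" for y
      unfolding V_def using x by (intro image_eqI[of _ _ x]) (auto simp: add.assoc[symmetric])
    thus ?thesis using \<F>(3) by auto
  qed
  ultimately show False using emeasure_UNIV by (simp add: null_sets_def)
qed

lemma open_contains_compact:
  fixes U :: "'g set"
  assumes U: "open U" "U \<noteq> {}"
  obtains E where "E \<in> sets borel" "E \<subseteq> U" "0 < emeasure M E" "emeasure M E < \<infinity>"
proof -
  have "0 < emeasure M U"
    using open_emeasure_pos[OF U] by (simp add: zero_less_iff_neq_zero)
  then obtain E where "compact E" "E \<in> sets borel" "E \<subseteq> U" "0 < emeasure M E"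
    unfolding inner_regular[OF U(1)] by (auto simp: less_SUP_iff)
  thus thesis using that compact_finite by blast
qed

lemma weight_bounded:
  fixes w :: "'g \<Rightarrow> real"
  assumes "weight w"
  obtains K where "\<And>x. 0 \<le> w x \<and> w x \<le> K"
proof -
  obtain K where "\<And>x. \<bar>w x\<bar> \<le> K"
    using assms by (auto simp: weight_def bounded_iff)
  thus thesis using that assms by (force simp: weight_def abs_le_iff less_imp_le)
qed

lemma weight_measurable:
  fixes w :: "'g \<Rightarrow> real"
  shows "weight w \<Longrightarrow> w \<in> borel_measurable borel"
  by (simp add: weight_def borel_measurable_continuous_onI)

text \<open>
  If \<open>w\<close> took values below every positive constant, the operator would shrink some nonzero
  function by more than its bounded inverse permits. The function is an indicator translated by
  $a^{-1}$, so that the translation in $T_{a,w}$ brings it onto the open set where \<open>w\<close> is small.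
\<close>

lemma invertible_imp_tame:
  fixes w :: "'g \<Rightarrow> real"
  assumes w: "weight w" and inv: "Lp_invertible M p (weighted_transl_op M p a w)"
  obtains d K where "tame d K w"
proof -
  let ?T = "weighted_transl_op M p a w"
  obtain K where K: "\<And>x. 0 \<le> w x \<and> w x \<le> K" using weight_bounded[OF w] by blast
  note wm = weight_measurable[OF w]
  from inv obtain L where bij: "bij_betw ?T (Lp M p) (Lp M p)"
    and L: "\<And>u. u \<in> Lp M p \<Longrightarrow> Lp_norm M p (inv_into (Lp M p) ?T u) \<le> L * Lp_norm M p u"
    by (auto simp: Lp_invertible_def)
  \<comment> \<open>a bound for the inverse that is certainly positive\<close>
  define L' where "L' = max L 1"
  have L': "1 \<le> L'" "L \<le> L'" by (auto simp: L'_def)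
  have expand: "lp_fnorm M p f \<le> L' * lp_fnorm M p (wshift a w f)" if f: "f \<in> lp_fun M p" for f
  proof -
    note F = wshift_lp(1)[OF wm K f, of a]
    have "inv_into (Lp M p) ?T (lp_class M p (wshift a w f)) = lp_class M p f"
      using inv_into_f_f[OF bij_betw_imp_inj_on[OF bij] lp_class_in_Lp[OF f]]
      by (simp add: weighted_transl_op_class[OF wm K f])
    hence "lp_fnorm M p f \<le> L * lp_fnorm M p (wshift a w f)"
      using L[OF lp_class_in_Lp[OF F]] f F by (simp add: Lp_norm_class)
    also have "\<dots> \<le> L' * lp_fnorm M p (wshift a w f)"
      using L' by (intro mult_right_mono lp_fnorm_nonneg)
    finally show ?thesis .
  qed
  \<comment> \<open>half of what the inverse permits, so that values of \<open>w\<close> below \<open>d\<close> are contradictory\<close>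
  define d where "d = 1 / (2 * L')"
  have d: "0 < d" "L' * d = 1 / 2" using L' by (auto simp: d_def)
  have "d \<le> w x" for x
  proof (rule ccontr)
    assume "\<not> d \<le> w x"
    define U where "U = {x. w x < d}"
    have "open U"
      unfolding U_def using w by (intro open_Collect_less continuous_on_const) (simp add: weight_def)
    moreover have "U \<noteq> {}" using \<open>\<not> d \<le> w x\<close> by (auto simp: U_def not_le)
    ultimately obtain E where E: "E \<in> sets borel" "E \<subseteq> U" "0 < emeasure M E" "emeasure M E < \<infinity>"
      by (rule open_contains_compact)
    define h :: "'g \<Rightarrow> complex" where "h = indicator E"
    have h_powr: "cmod (h x) powr p = indicator E x" for x
      using p by (simp add: h_def indicator_def)
    have h: "h \<in> lp_fun M p"
      using E sets_M by (auto simp: lp_fun_def h_powr) (simp add: h_def)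
    have "lp_fnorm M p h = measure M E powr (1 / p)"
      using E sets_M by (simp add: lp_fnorm_def h_powr space_M)
    moreover have "0 < measure M E"
      using E by (simp add: measure_def enn2real_positive_iff)
    ultimately have pos: "0 < lp_fnorm M p h" by simp
    define f where "f = translate (- a) h"
    have f: "f \<in> lp_fun M p" "lp_fnorm M p f = lp_fnorm M p h"
      unfolding f_def using translate_lp[OF h] by auto
    have "cmod (wshift a w f x) \<le> d * cmod (h x)" for x
      using E(2) K[of x] by (auto simp: f_def multiply_def translate_def h_def U_def norm_mult
          indicator_def less_imp_le)
    from lp_fun_dominated(2)[OF _ _ h _ this] wshift_lp(1)[OF wm K f(1), of a] p d
    have "lp_fnorm M p (wshift a w f) \<le> d * lp_fnorm M p h" by (simp add: lp_fun_def)
    hence "L' * lp_fnorm M p (wshift a w f) \<le> L' * (d * lp_fnorm M p h)"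
      using L' by (intro mult_left_mono) auto
    hence "lp_fnorm M p h \<le> L' * (d * lp_fnorm M p h)"
      using expand[OF f(1)] f(2) by linarith
    also have "\<dots> = lp_fnorm M p h / 2" using d(2) by (simp add: mult.assoc[symmetric])
    finally show False using pos by simp
  qed
  hence "tame d K w" using d K wm by (simp add: tame_def)
  thus thesis by (rule that)
qed

section \<open>Invariance of the set of irregular vectors and of its cone\<close>

end

text \<open>
  Membership in $DIV_{A,B}$ depends on the orbit norms only up to factors that are bounded above and
  away from $0$ uniformly along the orbit.
\<close>

lemma DIV_comparable:
  assumes x: "x \<in> DIV X nrm T A B" and y: "y \<in> X" and k: "0 < k"
    and nonneg: "\<And>n. 0 \<le> nrm ((T ^^ n) y)"
    and lower: "\<And>n. k * nrm ((T ^^ n) x) \<le> nrm ((T ^^ n) y)"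
    and upper: "\<And>n. nrm ((T ^^ n) y) \<le> K * nrm ((T ^^ n) x)"
  shows "y \<in> DIV X nrm T A B"
proof -
  have lim: "((\<lambda>n. nrm ((T ^^ n) x)) \<longlongrightarrow> 0) (along A)"
    and div: "filterlim (\<lambda>n. nrm ((T ^^ n) x)) at_top (along B)"
    using x by (auto simp: DIV_def)
  have "((\<lambda>n. K * nrm ((T ^^ n) x)) \<longlongrightarrow> 0) (along A)"
    using tendsto_mult_right_zero[OF lim] .
  hence "((\<lambda>n. nrm ((T ^^ n) y)) \<longlongrightarrow> 0) (along A)"
    by (rule tendsto_sandwich[OF _ _ tendsto_const, rotated 2]) (simp_all add: nonneg upper)
  moreover have "filterlim (\<lambda>n. k * nrm ((T ^^ n) x)) at_top (along B)"
    by (rule filterlim_tendsto_pos_mult_at_top[OF tendsto_const k div])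
  hence "filterlim (\<lambda>n. nrm ((T ^^ n) y)) at_top (along B)"
    by (rule filterlim_at_top_mono) (simp add: lower)
  ultimately show ?thesis using y by (simp add: DIV_def)
qed

lemma DIV_comparable_iff:
  assumes X: "x \<in> X" "y \<in> X" and k: "0 < k" "0 < K"
    and nonneg: "\<And>z n. z \<in> X \<Longrightarrow> 0 \<le> nrm ((T ^^ n) z)"
    and lower: "\<And>n. k * nrm ((T ^^ n) x) \<le> nrm ((T ^^ n) y)"
    and upper: "\<And>n. nrm ((T ^^ n) y) \<le> K * nrm ((T ^^ n) x)"
  shows "y \<in> DIV X nrm T A B \<longleftrightarrow> x \<in> DIV X nrm T A B"
proof
  assume "x \<in> DIV X nrm T A B"
  thus "y \<in> DIV X nrm T A B"
    by (rule DIV_comparable) (use assms in auto)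
next
  assume y: "y \<in> DIV X nrm T A B"
  show "x \<in> DIV X nrm T A B"
    by (rule DIV_comparable[OF y, of _ "1 / K" "1 / k"])
       (use assms in \<open>auto simp: field_simps\<close>)
qed

context haar_Lp
begin

text \<open>
  For \<open>b = 0\<close> the operator is a multiplication and commutes with the powers of \<open>T\<close>
  up to a translate of the multiplier. For \<open>b = a\<close> it is the multiplication by $u/w$ after
  \<open>T\<close>, which costs one further application of \<open>T\<close>.
\<close>

lemma tame_op_DIV_iff:
  assumes w: "tame d K w" and u: "tame d' K' u" and b: "b = 0 \<or> b = a" and y: "y \<in> Lp M p"
  defines "T \<equiv> weighted_transl_op M p a w"
  shows "weighted_transl_op M p b u y \<in> DIV (Lp M p) (Lp_norm M p) T A B
           \<longleftrightarrow> y \<in> DIV (Lp M p) (Lp_norm M p) T A B"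
proof -
  let ?S = "weighted_transl_op M p b u"
  let ?F = "wshift a w"
  obtain f where f: "f \<in> lp_fun M p" "y = lp_class M p f" using y by (rule LpE)
  have w': "w \<in> borel_measurable borel" "\<And>x. 0 \<le> w x \<and> w x \<le> K"
    using w tame_pos[OF w] by (auto simp: tame_def less_imp_le)
  note iter = weighted_transl_op_funpow[OF w', where b = a, folded T_def]
  have Sy: "?S y = lp_class M p (wshift b u f)" and Sf: "wshift b u f \<in> lp_fun M p"
    using tame_wshift[OF u f(1), of b] f(2) by auto
  have normT: "Lp_norm M p ((T ^^ n) y) = lp_fnorm M p ((?F ^^ n) f)"
    and normS: "Lp_norm M p ((T ^^ n) (?S y)) = lp_fnorm M p ((?F ^^ n) (wshift b u f))" for n
    using iter(3)[OF f(1)] iter(3)[OF Sf] f(2) Sy by auto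
  obtain k k' where k: "0 < k" "0 < k'"
    and comp: "\<And>n. k * lp_fnorm M p ((?F ^^ n) f) \<le> lp_fnorm M p ((?F ^^ n) (wshift b u f))"
      "\<And>n. lp_fnorm M p ((?F ^^ n) (wshift b u f)) \<le> k' * lp_fnorm M p ((?F ^^ n) f)"
  proof -
    have mult: "e * lp_fnorm M p ((?F ^^ n) g) \<le> lp_fnorm M p ((?F ^^ n) (multiply v g))"
      "lp_fnorm M p ((?F ^^ n) (multiply v g)) \<le> e' * lp_fnorm M p ((?F ^^ n) g)"
      if v: "tame e e' v" and g: "g \<in> lp_fun M p" for v g e e' n
      using tame_wshift[OF tame_translate_funpow[OF v] iter(1)[OF g], where b = 0]
      by (simp_all add: wshift_funpow_multiply translate_def[of 0])
    show thesis
    proof (cases "b = 0")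
      case True
      have "0 < d'" "0 < K'" using u tame_bounds_le[OF u] by (auto simp: tame_def)
      thus thesis using that[of d' K'] mult[OF u f(1)] True by (simp add: translate_def)
    next
      case False
      hence ba: "b = a" using b by simp
      define v where "v x = u x * (1 / w x)" for x
      have v: "tame (d' * (1 / K)) (K' * (1 / d)) v"
        unfolding v_def by (rule tame_mult[OF u tame_inverse[OF w]])
      \<comment> \<open>the weight of \<open>T\<close> is divided out, which reduces translation by \<open>a\<close> to \<open>T\<close>\<close>
      have eq: "wshift b u f = multiply v (?F f)"
        using tame_pos[OF w] unfolding ba
        by (auto simp: multiply_def v_def fun_eq_iff) (metis less_irrefl)
      note Ff = tame_wshift(1)[OF w f(1), of a]
      have swap: "(?F ^^ n) (?F f) = ?F ((?F ^^ n) f)" for n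
        using funpow_swap1[of ?F n f] by simp
      have pos: "0 < d' * (1 / K)" "0 < K' * (1 / d)" "0 < d" "0 < K"
        using u w tame_bounds_le[OF u] tame_bounds_le[OF w] by (auto simp: tame_def)
      show thesis
      proof (rule that[of "d' * (1 / K) * d" "K' * (1 / d) * K"])
        fix n
        note G = tame_wshift(2,3)[OF w iter(1)[OF f(1)], where b = a]
        have "d' * (1 / K) * (d * lp_fnorm M p ((?F ^^ n) f))
            \<le> d' * (1 / K) * lp_fnorm M p (?F ((?F ^^ n) f))"
          using pos G by (intro mult_left_mono) auto
        also have "\<dots> \<le> lp_fnorm M p ((?F ^^ n) (wshift b u f))"
          using mult(1)[OF v Ff, of n] by (simp only: eq swap)
        finally show "d' * (1 / K) * d * lp_fnorm M p ((?F ^^ n) f)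
            \<le> lp_fnorm M p ((?F ^^ n) (wshift b u f))"
          by (simp only: mult.assoc)
        have "lp_fnorm M p ((?F ^^ n) (wshift b u f))
            \<le> K' * (1 / d) * lp_fnorm M p (?F ((?F ^^ n) f))"
          using mult(2)[OF v Ff, of n] by (simp only: eq swap)
        also have "\<dots> \<le> K' * (1 / d) * (K * lp_fnorm M p ((?F ^^ n) f))"
          using pos G by (intro mult_left_mono) auto
        finally show "lp_fnorm M p ((?F ^^ n) (wshift b u f))
            \<le> K' * (1 / d) * K * lp_fnorm M p ((?F ^^ n) f)"
          by (simp only: mult.assoc)
      qed (rule mult_pos_pos[OF pos(1,3)], rule mult_pos_pos[OF pos(2,4)])
    qed
  qed
  have SyX: "?S y \<in> Lp M p" using Sy Sf lp_class_in_Lp by simp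
  have T_nonneg: "0 \<le> Lp_norm M p ((T ^^ n) z)" if "z \<in> Lp M p" for z n
    using that by (rule LpE) (simp add: iter(3) lp_fnorm_nonneg)
  show ?thesis
    by (rule DIV_comparable_iff[where nrm = "Lp_norm M p" and T = T, OF y _ k T_nonneg])
       (use comp SyX in \<open>simp_all add: normT normS\<close>)
qed

text \<open>
  A positive weight lets a weighted translation $S$ act on a cone combination term by term. Applied to the
  $S$-preimages of the representatives, the same identity produces a cone element that
  $S$ maps to the given one; injectivity then identifies it as the value of the inverse.
  The inverse operator thus needs no invariance argument of its own.
\<close>

lemma tame_op_cone:
  assumes u: "tame d K u" and D: "D \<subseteq> Lp M p"
    and inv: "\<And>y. y \<in> Lp M p \<Longrightarrow> weighted_transl_op M p b u y \<in> D \<longleftrightarrow> y \<in> D"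
  shows "weighted_transl_op M p b u ` Lp_cone M p D \<subseteq> Lp_cone M p D"
    and "inv_into (Lp M p) (weighted_transl_op M p b u) ` Lp_cone M p D \<subseteq> Lp_cone M p D"
proof -
  let ?S = "weighted_transl_op M p b u"
  have p': "0 < p" using p by simp
  have u0: "0 \<le> u x" for x using tame_pos[OF u, of x] by simp
  have S_cone: "?S (lp_class M p (cone_fun m c f)) = lp_class M p (cone_fun m c (\<lambda>j. wshift b u (f j)))"
    if "\<And>j. j < m \<Longrightarrow> 0 < c j" "\<And>j. j < m \<Longrightarrow> f j \<in> lp_fun M p" for m c f
    using tame_wshift(4)[OF u cone_fun_lp(1)[OF p' that]] by (simp add: wshift_cone_fun[OF u0])
  show "?S ` Lp_cone M p D \<subseteq> Lp_cone M p D"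
  proof (rule image_subsetI)
    fix z assume "z \<in> Lp_cone M p D"
    then obtain m c y f where j: "\<And>j. j < m \<Longrightarrow> 0 < c j \<and> y j \<in> D \<and> f j \<in> y j"
      and z: "z = lp_class M p (cone_fun m c f)" by (rule Lp_coneE) blast
    have f: "f j \<in> lp_fun M p" "y j = lp_class M p (f j)" if "j < m" for j
      using Lp_member j[OF that] D by blast+
    have "0 < c j \<and> ?S (y j) \<in> D \<and> wshift b u (f j) \<in> ?S (y j)" if "j < m" for j
      using j[OF that] f[OF that] tame_wshift[OF u f(1)[OF that], of b] inv[of "y j"] D
        lp_class_self by auto
    hence "lp_class M p (cone_fun m c (\<lambda>j. wshift b u (f j))) \<in> Lp_cone M p D"
      by (rule Lp_coneI)
    thus "?S z \<in> Lp_cone M p D"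
      using j f by (simp add: z S_cone)
  qed
  show "inv_into (Lp M p) ?S ` Lp_cone M p D \<subseteq> Lp_cone M p D"
  proof (rule image_subsetI)
    fix z assume "z \<in> Lp_cone M p D"
    then obtain m c y f where j: "\<And>j. j < m \<Longrightarrow> 0 < c j \<and> y j \<in> D \<and> f j \<in> y j"
      and z: "z = lp_class M p (cone_fun m c f)" by (rule Lp_coneE) blast
    have f: "f j \<in> lp_fun M p" "y j = lp_class M p (f j)" if "j < m" for j
      using Lp_member j[OF that] D by blast+
    define g where "g j = wshift (- b) (\<lambda>x. 1 / u (x + b)) (f j)" for j
    have g: "g j \<in> lp_fun M p" if "j < m" for j
      unfolding g_def by (rule tame_wshift(1)[OF tame_wshift_inverse_tame[OF u] f(1)[OF that]])
    have Fg: "wshift b u (g j) = f j" for j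
      unfolding g_def by (rule wshift_inverse(1)) (use tame_pos[OF u] in \<open>metis less_irrefl\<close>)
    have "0 < c j \<and> lp_class M p (g j) \<in> D \<and> g j \<in> lp_class M p (g j)" if "j < m" for j
      using j[OF that] f[OF that] g[OF that] tame_wshift(4)[OF u g[OF that], of b]
        inv[OF lp_class_in_Lp[OF g[OF that]]] Fg lp_class_self by auto
    hence "lp_class M p (cone_fun m c g) \<in> Lp_cone M p D"
      by (rule Lp_coneI)
    moreover have "?S (lp_class M p (cone_fun m c g)) = z"
      using j g by (simp add: z S_cone Fg)
    moreover have "lp_class M p (cone_fun m c g) \<in> Lp M p"
      using cone_fun_lp(1)[OF p'] j g by (intro lp_class_in_Lp) blast
    ultimately show "inv_into (Lp M p) ?S z \<in> Lp_cone M p D"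
      using inv_into_f_f[OF bij_betw_imp_inj_on[OF tame_op_bij[OF u]]] by metis
  qed
qed

text \<open>
  Nonnegative terms cannot cancel: the sum dominates each of its terms, so one term that diverges along
  \<open>B\<close> suffices, while along \<open>A\<close> all the terms tend to $0$. Nonzeroness excludes the empty
  combination.
\<close>

lemma cone_nonzero_irregular:
  fixes w :: "'g \<Rightarrow> real" and a :: 'g
  assumes w: "weight w"
  defines "T \<equiv> weighted_transl_op M p a w"
  assumes u: "u \<in> Lp_cone M p (DIV (Lp M p) (Lp_norm M p) T A B)"
    and nz: "u \<noteq> lp_class M p (\<lambda>_. 0)"
  shows "u \<in> DIV (Lp M p) (Lp_norm M p) T A B"
proof -
  let ?D = "DIV (Lp M p) (Lp_norm M p) T A B"
  let ?F = "wshift a w"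
  have p': "0 < p" using p by simp
  obtain m c y f where j: "\<And>j. j < m \<Longrightarrow> 0 < c j \<and> y j \<in> ?D \<and> f j \<in> y j"
    and eq: "u = lp_class M p (cone_fun m c f)" using u by (rule Lp_coneE) blast
  have c: "0 < c j" if "j < m" for j using j[OF that] by simp
  have f: "f j \<in> lp_fun M p" "y j = lp_class M p (f j)" if "j < m" for j
    using Lp_member[of "y j" M p "f j"] j[OF that] by (auto simp: DIV_def)
  have m: "0 < m"
  proof (rule ccontr)
    assume "\<not> 0 < m"
    hence "cone_fun m c f = (\<lambda>_. 0)" by (simp add: cone_fun_def)
    thus False using nz eq by simp
  qed
  obtain K where K: "\<And>x. 0 \<le> w x \<and> w x \<le> K" using weight_bounded[OF w] by blast
  note iter = weighted_transl_op_funpow[OF weight_measurable[OF w] K, where b = a, folded T_def]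
  have sum_lp: "cone_fun m c f \<in> lp_fun M p"
    by (rule cone_fun_lp(1)[OF p' c f(1)])
  have norm_u: "Lp_norm M p ((T ^^ n) u) = lp_fnorm M p (cone_fun m c (\<lambda>j. (?F ^^ n) (f j)))" for n
    using iter(3)[OF sum_lp] K by (simp add: eq wshift_funpow_cone_fun)
  have lim: "((\<lambda>n. lp_fnorm M p ((?F ^^ n) (f j))) \<longlongrightarrow> 0) (along A)" if "j < m" for j
    using j[OF that] f[OF that] by (simp add: DIV_def iter(3))
  have div: "filterlim (\<lambda>n. lp_fnorm M p ((?F ^^ n) (f j))) at_top (along B)" if "j < m" for j
    using j[OF that] f[OF that] by (simp add: DIV_def iter(3))
  have "((\<lambda>n. (real m powr p * (\<Sum>j<m. c j powr p * lp_fnorm M p ((?F ^^ n) (f j)) powr p)) powr (1 / p))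
      \<longlongrightarrow> (real m powr p * (\<Sum>j<m. c j powr p * 0 powr p)) powr (1 / p)) (along A)"
    using p' lim
    by (intro tendsto_powr' tendsto_mult tendsto_sum tendsto_const)
       (auto intro!: always_eventually mult_nonneg_nonneg sum_nonneg lp_fnorm_nonneg)
  hence "((\<lambda>n. (real m powr p * (\<Sum>j<m. c j powr p * lp_fnorm M p ((?F ^^ n) (f j)) powr p)) powr (1 / p))
      \<longlongrightarrow> 0) (along A)" by simp
  hence "((\<lambda>n. Lp_norm M p ((T ^^ n) u)) \<longlongrightarrow> 0) (along A)"
    by (rule tendsto_sandwich[OF _ _ tendsto_const, rotated 2])
       (use cone_fun_lp(2)[OF p' c iter(1)[OF f(1)]] in \<open>simp_all add: norm_u lp_fnorm_nonneg\<close>)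
  moreover have "filterlim (\<lambda>n. Lp_norm M p ((T ^^ n) u)) at_top (along B)"
  proof (rule filterlim_at_top_mono)
    show "filterlim (\<lambda>n. c 0 * lp_fnorm M p ((?F ^^ n) (f 0))) at_top (along B)"
      by (rule filterlim_tendsto_pos_mult_at_top[OF tendsto_const c[OF m] div[OF m]])
    have "c 0 * lp_fnorm M p ((?F ^^ n) (f 0)) \<le> Lp_norm M p ((T ^^ n) u)" for n
    proof -
      let ?g = "\<lambda>j. (?F ^^ n) (f j)"
      note g = cone_fun_lp(1)[of p m c ?g M, OF p' c iter(1)[OF f(1)]]
      have "cmod (?g 0 x) \<le> (1 / c 0) * cmod (cone_fun m c ?g x)" for x
      proof -
        have "c 0 * cmod (?g 0 x) \<le> (\<Sum>j<m. c j * cmod (?g j x))"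
          by (rule member_le_sum[of 0 "{..<m}" "\<lambda>j. c j * cmod (?g j x)"])
             (use m c in \<open>auto simp: less_imp_le\<close>)
        thus ?thesis using c[OF m] by (simp add: cmod_cone_fun[OF c] field_simps)
      qed
      from lp_fun_dominated(2)[OF p' _ g _ this] iter(1)[OF f(1)[OF m]] c[OF m]
      have "lp_fnorm M p (?g 0) \<le> (1 / c 0) * lp_fnorm M p (cone_fun m c ?g)"
        by (simp add: lp_fun_def)
      thus ?thesis using c[OF m] by (simp add: norm_u field_simps)
    qed
    thus "\<forall>\<^sub>F n in along B. c 0 * lp_fnorm M p ((?F ^^ n) (f 0)) \<le> Lp_norm M p ((T ^^ n) u)"
      by simp
  qed
  ultimately show ?thesis
    using lp_class_in_Lp[OF sum_lp] by (simp add: DIV_def eq)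
qed

end

theorem theorem3p5:
  fixes M :: "'g::{topological_group_add, second_countable_topology, t2_space} measure"
    and p :: real and a :: 'g and w :: "'g \<Rightarrow> real" and A B :: "nat set"
  defines "T \<equiv> weighted_transl_op M p a w"
  defines "D \<equiv> DIV (Lp M p) (Lp_norm M p) T A B"
  defines "C \<equiv> Lp_cone M p D"
  assumes "locally_compact_space (euclidean :: 'g topology)"
    and "right_haar_measure M"
    and "1 \<le> p"
    and "weight w"
    and "dist_chaotic (Lp M p) (Lp_norm M p) (Lp_minus M p) T"
    and "A \<subseteq> {1..}" and "B \<subseteq> {1..}"
    and "upper_dens A = 1" and "upper_dens B = 1"
    and "D \<noteq> {}"
  shows "(\<forall>u\<in>C. u \<noteq> lp_class M p (\<lambda>_. 0) \<longrightarrow>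
            dist_irregular (Lp M p) (Lp_norm M p) T u) \<and>
         (Lp_invertible M p T \<longrightarrow>
            (\<forall>S \<in> {transl_op M p a, T, mult_op M p w}
                  \<union> {mult_op M p (translate (gpow n a) w) | n :: int. True}
                  \<union> {mult_op M p (weight_prod a w n) | n :: nat. 1 \<le> n}.
               Lp_invertible M p S \<and> S ` C \<subseteq> C \<and> inv_into (Lp M p) S ` C \<subseteq> C))"
proof (intro conjI impI ballI)
  interpret haar_Lp M p by unfold_locales fact+
  fix u assume "u \<in> C" "u \<noteq> lp_class M p (\<lambda>_. 0)"
  hence "u \<in> D"
    unfolding C_def D_def T_def by (rule cone_nonzero_irregular[OF \<open>weight w\<close>])
  thus "dist_irregular (Lp M p) (Lp_norm M p) T u"
    unfolding dist_irregular_def D_def[symmetric]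
    using assms(9-12) unfolding D_def by blast
next
  interpret haar_Lp M p by unfold_locales fact+
  fix S
  assume inv: "Lp_invertible M p T"
    and S: "S \<in> {transl_op M p a, T, mult_op M p w}
                  \<union> {mult_op M p (translate (gpow n a) w) | n :: int. True}
                  \<union> {mult_op M p (weight_prod a w n) | n :: nat. 1 \<le> n}"
  obtain d K where w: "tame d K w"
    using invertible_imp_tame[OF \<open>weight w\<close>] inv unfolding T_def by blast
  have prod: "tame (d ^ n) (K ^ n) (weight_prod a w n)" for n
    using tame_prod[of "{1..n}" d K "\<lambda>j. translate (gpow (- int j) a) w"] tame_translate[OF w]
    by (simp add: weight_prod_def)
  \<comment> \<open>all the listed operators are weighted translations with a tame weight\<close>
  have "\<exists>b u k k'. (b = 0 \<or> b = a) \<and> tame k k' u \<and> S = weighted_transl_op M p b u"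
  proof -
    have one: "tame 1 1 (\<lambda>_ :: 'g. 1)" by (simp add: tame_def)
    show ?thesis
      using S w one tame_translate[OF w] prod unfolding mult_op_eq transl_op_eq T_def by blast
  qed
  then obtain b u k k' where b: "b = 0 \<or> b = a" and u: "tame k k' u"
    and S_eq: "S = weighted_transl_op M p b u" by blast
  have D: "D \<subseteq> Lp M p" by (auto simp: D_def DIV_def)
  have iff: "weighted_transl_op M p b u y \<in> D \<longleftrightarrow> y \<in> D" if "y \<in> Lp M p" for y
    unfolding D_def T_def by (rule tame_op_DIV_iff[OF w u b that])
  show "Lp_invertible M p S" unfolding S_eq by (rule tame_op_invertible[OF u])
  show "S ` C \<subseteq> C" "inv_into (Lp M p) S ` C \<subseteq> C"
    unfolding S_eq C_def by (rule tame_op_cone[OF u D iff]; assumption)+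
qed

end
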